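(* Let $G$ be an $n$-dimensional Lie group with Lie algebra $\mathfrak{g}$ and a left-invariant Riemannian metric $\mathsf{h}$, inducing the inner product $\langle\,,\rangle$ on $\mathfrak{g}$. Let $X\in\mathfrak{g}$ be a non-zero left-invariant vector field with $\|X\|=\sqrt{\langle X,X\rangle}<1$. Let $g_X$ be the left-invariant Riemannian metric on $G$ given on $\mathfrak{g}$ by $$g_X(v,z)=(1+\|X\|)\Big(\langle v,z\rangle+\frac{1}{\|X\|}\langle X,v\rangle\langle X,z\rangle\Big),$$ let $\phi:\mathfrak{g}\to\mathfrak{g}$ be the linear map with $g_X(v,z)=\langle v,\phi(z)\rangle$ for all $v,z\in\mathfrak{g}$, let $\{X_1,\dots,X_n\}$ be a $\langle\,,\rangle$-orthonormal basis of $\mathfrak{g}$ consisting of eigenvectors of $\phi$, with $\phi(X_i)=\lambda_iX_i$, and let $\alpha_{ijk}$ be the structure constants defined by $[X_i,X_j]=\sum_{k=1}^n\alpha_{ijk}X_k$. Then for all $i\ne j$ the sectional curvature $K(X_i,X_j)$ of $g_X$ on the plane spanned by $X_i,X_j$ is \begin{align*} K(X_i,X_j)=\frac14\sum_{l=1}^n\Big(&-\frac{4}{\lambda_l}\alpha_{ljj}\alpha_{lii}-\frac{2}{\lambda_l}\alpha_{lji}\alpha_{ilj}+\frac{2}{\lambda_j}\alpha_{ijl}\alpha_{jli}+\frac{2}{\lambda_i}\alpha_{ilj}\alpha_{jil}\\ &-\frac{3\lambda_l}{\lambda_i\lambda_j}\alpha_{ijl}^2+\frac{\lambda_j}{\lambda_i\lambda_l}\alpha_{ilj}^2+\frac{\lambda_i}{\lambda_j\lambda_l}\alpha_{lji}^2\Big).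 \end{align*}
   Context: Elements of $\mathfrak{g}$ are identified with left-invariant vector fields on $G$. The curvature tensor convention is $R(U,V)W=\nabla_U\nabla_VW-\nabla_V\nabla_UW-\nabla_{[U,V]}W$, and the sectional curvature is $K(U,V)=g_X(R(U,V)V,U)/(g_X(U,U)g_X(V,V)-g_X(U,V)^2)$. *)

theory Defs
  imports "HOL-Analysis.Analysis" "HOL-Algebra.Group"
begin

section \<open>Smooth functions between Euclidean spaces\<close>

text \<open>Only meaningful for open \<open>S\<close>: \<open>Ck_on k S f\<close> says that \<open>f\<close> is \<open>k\<close> times continuously
  differentiable on \<open>S\<close>, through iterated directional derivatives (the domain has finite
  dimension).\<close>

primrec Ck_on :: "nat \<Rightarrow> 'a::euclidean_space set \<Rightarrow> ('a \<Rightarrow> 'b::real_normed_vector) \<Rightarrow> bool" where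
  "Ck_on 0 S f \<longleftrightarrow> continuous_on S f"
| "Ck_on (Suc k) S f \<longleftrightarrow>
     (\<forall>x\<in>S. f differentiable (at x)) \<and> (\<forall>v. Ck_on k S (\<lambda>x. frechet_derivative f (at x) v))"

definition smooth_on :: "'a::euclidean_space set \<Rightarrow> ('a \<Rightarrow> 'b::real_normed_vector) \<Rightarrow> bool" where
  "smooth_on S f \<longleftrightarrow> (\<forall>k. Ck_on k S f)"


section \<open>Smooth manifolds\<close>

text \<open>A chart is its domain together with its coordinate map. The model space is a Euclidean
  space \<open>'e\<close>, so that the manifold has dimension \<open>DIM('e)\<close>.\<close>

type_synonym ('g, 'e) chart = "'g set \<times> ('g \<Rightarrow> 'e)"

abbreviation inv_chart :: "('g, 'e) chart \<Rightarrow> 'e \<Rightarrow> 'g" where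
  "inv_chart c \<equiv> inv_into (fst c) (snd c)"

record ('g, 'e) manifold =
  mtop :: "'g topology"
  atlas :: "('g, 'e) chart set"

abbreviation points :: "('g, 'e) manifold \<Rightarrow> 'g set" where
  "points M \<equiv> topspace (mtop M)"

definition smooth_manifold :: "('g, 'e::euclidean_space) manifold \<Rightarrow> bool" where
  "smooth_manifold M \<longleftrightarrow>
     Hausdorff_space (mtop M) \<and> second_countable (mtop M) \<and>
     (\<Union>c\<in>atlas M. fst c) = points M \<and>
     (\<forall>c\<in>atlas M. openin (mtop M) (fst c) \<and> open (snd c ` fst c) \<and>
        homeomorphic_map (subtopology (mtop M) (fst c)) (top_of_set (snd c ` fst c)) (snd c)) \<and>
     (\<forall>c\<in>atlas M. \<forall>d\<in>atlas M.
        smooth_on (snd c ` (fst c \<inter> fst d)) (snd d \<circ> inv_chart c))"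

definition smooth_map ::
  "('g, 'e::euclidean_space) manifold \<Rightarrow> ('h, 'f::euclidean_space) manifold \<Rightarrow> ('g \<Rightarrow> 'h) \<Rightarrow> bool" where
  "smooth_map M N F \<longleftrightarrow>
     continuous_map (mtop M) (mtop N) F \<and>
     (\<forall>c\<in>atlas M. \<forall>d\<in>atlas N.
        smooth_on (snd c ` {p \<in> fst c. F p \<in> fst d}) (snd d \<circ> F \<circ> inv_chart c))"

definition smooth_fun :: "('g, 'e::euclidean_space) manifold \<Rightarrow> ('g \<Rightarrow> real) \<Rightarrow> bool" where
  "smooth_fun M f \<longleftrightarrow> (\<forall>c\<in>atlas M. smooth_on (snd c ` fst c) (f \<circ> inv_chart c))"

definition prod_manifold ::
  "('g, 'e) manifold \<Rightarrow> ('h, 'f) manifold \<Rightarrow> ('g \<times> 'h, 'e \<times> 'f) manifold" where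
  "prod_manifold M N =
     \<lparr>mtop = prod_topology (mtop M) (mtop N),
      atlas = {(fst c \<times> fst d, map_prod (snd c) (snd d)) | c d. c \<in> atlas M \<and> d \<in> atlas N}\<rparr>"


section \<open>Tangent vectors\<close>

text \<open>At every point \<open>p\<close> one preferred chart is fixed, and a tangent vector at \<open>p\<close> is represented
  by its coordinates in that chart. Thus each tangent space is \<open>'e\<close>, and tangent vectors at
  different points are comparable only through charts or tangent maps. By the chain rule the
  notions below do not depend on the choice.\<close>

definition chart_at :: "('g, 'e) manifold \<Rightarrow> 'g \<Rightarrow> ('g, 'e) chart" where
  "chart_at M p = (SOME c. c \<in> atlas M \<and> p \<in> fst c)"

text \<open>Derivative at \<open>p\<close> of a vector-valued function on the manifold, applied to a tangent vector
  at \<open>p\<close>.\<close>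

definition mderiv ::
  "('g, 'e::euclidean_space) manifold \<Rightarrow> 'g \<Rightarrow> ('g \<Rightarrow> 'b::real_normed_vector) \<Rightarrow> 'e \<Rightarrow> 'b" where
  "mderiv M p f v =
     frechet_derivative (f \<circ> inv_chart (chart_at M p)) (at (snd (chart_at M p) p)) v"

definition tangent_map ::
  "('g, 'e::euclidean_space) manifold \<Rightarrow> ('h, 'f::euclidean_space) manifold \<Rightarrow> ('g \<Rightarrow> 'h) \<Rightarrow> 'g \<Rightarrow> 'e \<Rightarrow> 'f" where
  "tangent_map M N F p v = mderiv M p (snd (chart_at N (F p)) \<circ> F) v"

text \<open>The tangent vector at \<open>p\<close> whose coordinates in the chart \<open>c\<close> around \<open>p\<close> are \<open>v\<close>.\<close>

definition coord_vector ::
  "('g, 'e::euclidean_space) manifold \<Rightarrow> ('g, 'e) chart \<Rightarrow> 'g \<Rightarrow> 'e \<Rightarrow> 'e" where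
  "coord_vector M c p v =
     frechet_derivative (snd (chart_at M p) \<circ> inv_chart c) (at (snd c p)) v"


section \<open>Vector fields\<close>

text \<open>The coordinate expression of a vector field in the chart \<open>c\<close>.\<close>

definition in_chart ::
  "('g, 'e::euclidean_space) manifold \<Rightarrow> ('g, 'e) chart \<Rightarrow> ('g \<Rightarrow> 'e) \<Rightarrow> 'e \<Rightarrow> 'e" where
  "in_chart M c X x = mderiv M (inv_chart c x) (snd c) (X (inv_chart c x))"

text \<open>Vector fields are set to 0 off the manifold, so that equality of vector fields is equality
  of functions.\<close>

definition vector_fields :: "('g, 'e::euclidean_space) manifold \<Rightarrow> ('g \<Rightarrow> 'e) set" where
  "vector_fields M =
     {X. (\<forall>c\<in>atlas M. smooth_on (snd c ` fst c) (in_chart M c X)) \<and> (\<forall>p. p \<notin> points M \<longrightarrow> X p = 0)}"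

text \<open>In coordinates \<open>[X,Y] = DY(X) - DX(Y)\<close>, that is, \<open>[X,Y] f = X (Y f) - Y (X f)\<close>.\<close>

definition lie_bracket ::
  "('g, 'e::euclidean_space) manifold \<Rightarrow> ('g \<Rightarrow> 'e) \<Rightarrow> ('g \<Rightarrow> 'e) \<Rightarrow> 'g \<Rightarrow> 'e" where
  "lie_bracket M X Y p =
     (if p \<in> points M then
        let c = chart_at M p; x = snd c p in
          frechet_derivative (in_chart M c Y) (at x) (X p)
          - frechet_derivative (in_chart M c X) (at x) (Y p)
      else 0)"


section \<open>Riemannian metrics, Levi-Civita connection and curvature\<close>

definition riemannian_metric ::
  "('g, 'e::euclidean_space) manifold \<Rightarrow> ('g \<Rightarrow> 'e \<Rightarrow> 'e \<Rightarrow> real) \<Rightarrow> bool" where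
  "riemannian_metric M g \<longleftrightarrow>
     (\<forall>p\<in>points M. bilinear (g p) \<and> (\<forall>v w. g p v w = g p w v) \<and> (\<forall>v. v \<noteq> 0 \<longrightarrow> g p v v > 0)) \<and>
     (\<forall>c\<in>atlas M. \<forall>v w. smooth_on (snd c ` fst c)
        (\<lambda>x. g (inv_chart c x) (coord_vector M c (inv_chart c x) v)
                               (coord_vector M c (inv_chart c x) w)))"

definition affine_connection ::
  "('g, 'e::euclidean_space) manifold \<Rightarrow> (('g \<Rightarrow> 'e) \<Rightarrow> ('g \<Rightarrow> 'e) \<Rightarrow> 'g \<Rightarrow> 'e) \<Rightarrow> bool" where
  "affine_connection M nabla \<longleftrightarrow>
     (\<forall>U\<in>vector_fields M. \<forall>V\<in>vector_fields M. nabla U V \<in> vector_fields M) \<and>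
     (\<forall>U\<in>vector_fields M. \<forall>U'\<in>vector_fields M. \<forall>V\<in>vector_fields M.
        nabla (\<lambda>p. U p + U' p) V = (\<lambda>p. nabla U V p + nabla U' V p)) \<and>
     (\<forall>f. smooth_fun M f \<longrightarrow> (\<forall>U\<in>vector_fields M. \<forall>V\<in>vector_fields M.
        nabla (\<lambda>p. f p *\<^sub>R U p) V = (\<lambda>p. f p *\<^sub>R nabla U V p))) \<and>
     (\<forall>U\<in>vector_fields M. \<forall>V\<in>vector_fields M. \<forall>V'\<in>vector_fields M.
        nabla U (\<lambda>p. V p + V' p) = (\<lambda>p. nabla U V p + nabla U V' p)) \<and>
     (\<forall>f. smooth_fun M f \<longrightarrow> (\<forall>U\<in>vector_fields M. \<forall>V\<in>vector_fields M.
        nabla U (\<lambda>p. f p *\<^sub>R V p) = (\<lambda>p. f p *\<^sub>R nabla U V p + mderiv M p f (U p) *\<^sub>R V p)))"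

definition levi_civita_connection ::
  "('g, 'e::euclidean_space) manifold \<Rightarrow> ('g \<Rightarrow> 'e \<Rightarrow> 'e \<Rightarrow> real) \<Rightarrow>
     (('g \<Rightarrow> 'e) \<Rightarrow> ('g \<Rightarrow> 'e) \<Rightarrow> 'g \<Rightarrow> 'e) \<Rightarrow> bool" where
  "levi_civita_connection M g nabla \<longleftrightarrow>
     affine_connection M nabla \<and>
     (\<forall>U\<in>vector_fields M. \<forall>V\<in>vector_fields M. \<forall>W\<in>vector_fields M. \<forall>p\<in>points M.
        mderiv M p (\<lambda>q. g q (V q) (W q)) (U p)
          = g p (nabla U V p) (W p) + g p (V p) (nabla U W p)) \<and>
     (\<forall>U\<in>vector_fields M. \<forall>V\<in>vector_fields M.
        (\<lambda>p. nabla U V p - nabla V U p) = lie_bracket M U V)"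

definition curvature ::
  "('g, 'e::euclidean_space) manifold \<Rightarrow> (('g \<Rightarrow> 'e) \<Rightarrow> ('g \<Rightarrow> 'e) \<Rightarrow> 'g \<Rightarrow> 'e) \<Rightarrow>
     ('g \<Rightarrow> 'e) \<Rightarrow> ('g \<Rightarrow> 'e) \<Rightarrow> ('g \<Rightarrow> 'e) \<Rightarrow> 'g \<Rightarrow> 'e" where
  "curvature M nabla U V W p =
     nabla U (nabla V W) p - nabla V (nabla U W) p - nabla (lie_bracket M U V) W p"

definition sectional_curvature ::
  "('g, 'e::euclidean_space) manifold \<Rightarrow> ('g \<Rightarrow> 'e \<Rightarrow> 'e \<Rightarrow> real) \<Rightarrow>
     (('g \<Rightarrow> 'e) \<Rightarrow> ('g \<Rightarrow> 'e) \<Rightarrow> 'g \<Rightarrow> 'e) \<Rightarrow> ('g \<Rightarrow> 'e) \<Rightarrow> ('g \<Rightarrow> 'e) \<Rightarrow> 'g \<Rightarrow> real" where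
  "sectional_curvature M g nabla U V p =
     g p (curvature M nabla U V V p) (U p) /
       (g p (U p) (U p) * g p (V p) (V p) - (g p (U p) (V p))\<^sup>2)"


section \<open>Lie groups\<close>

definition lie_group :: "'g monoid \<Rightarrow> ('g, 'e::euclidean_space) manifold \<Rightarrow> bool" where
  "lie_group G M \<longleftrightarrow>
     group G \<and> smooth_manifold M \<and> carrier G = points M \<and>
     smooth_map (prod_manifold M M) M (\<lambda>(a, b). a \<otimes>\<^bsub>G\<^esub> b) \<and>
     smooth_map M M (\<lambda>a. inv\<^bsub>G\<^esub> a)"

abbreviation left_translation_map ::
  "'g monoid \<Rightarrow> ('g, 'e::euclidean_space) manifold \<Rightarrow> 'g \<Rightarrow> 'g \<Rightarrow> 'e \<Rightarrow> 'e" where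
  "left_translation_map G M a \<equiv> tangent_map M M (\<lambda>q. a \<otimes>\<^bsub>G\<^esub> q)"

definition lie_algebra :: "'g monoid \<Rightarrow> ('g, 'e::euclidean_space) manifold \<Rightarrow> ('g \<Rightarrow> 'e) set" where
  "lie_algebra G M =
     {X \<in> vector_fields M. \<forall>a\<in>carrier G. \<forall>p\<in>carrier G.
        X (a \<otimes>\<^bsub>G\<^esub> p) = left_translation_map G M a p (X p)}"

definition left_invariant_metric ::
  "'g monoid \<Rightarrow> ('g, 'e::euclidean_space) manifold \<Rightarrow> ('g \<Rightarrow> 'e \<Rightarrow> 'e \<Rightarrow> real) \<Rightarrow> bool" where
  "left_invariant_metric G M g \<longleftrightarrow>
     riemannian_metric M g \<and>
     (\<forall>a\<in>carrier G. \<forall>p\<in>carrier G. \<forall>v w.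
        g (a \<otimes>\<^bsub>G\<^esub> p) (left_translation_map G M a p v) (left_translation_map G M a p w) = g p v w)"

text \<open>The inner product induced on the Lie algebra; for a left-invariant metric any other point
  could be used instead of the identity.\<close>

definition induced_inner ::
  "'g monoid \<Rightarrow> ('g \<Rightarrow> 'e \<Rightarrow> 'e \<Rightarrow> real) \<Rightarrow> ('g \<Rightarrow> 'e) \<Rightarrow> ('g \<Rightarrow> 'e) \<Rightarrow> real" where
  "induced_inner G h X Y = h \<one>\<^bsub>G\<^esub> (X \<one>\<^bsub>G\<^esub>) (Y \<one>\<^bsub>G\<^esub>)"

definition induced_norm ::
  "'g monoid \<Rightarrow> ('g \<Rightarrow> 'e \<Rightarrow> 'e \<Rightarrow> real) \<Rightarrow> ('g \<Rightarrow> 'e) \<Rightarrow> real" where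
  "induced_norm G h X = sqrt (induced_inner G h X X)"

definition linear_endo :: "('g \<Rightarrow> 'e::real_vector) set \<Rightarrow> (('g \<Rightarrow> 'e) \<Rightarrow> 'g \<Rightarrow> 'e) \<Rightarrow> bool" where
  "linear_endo L \<phi> \<longleftrightarrow>
     (\<forall>v\<in>L. \<phi> v \<in> L) \<and>
     (\<forall>v\<in>L. \<forall>z\<in>L. \<phi> (\<lambda>p. v p + z p) = (\<lambda>p. \<phi> v p + \<phi> z p)) \<and>
     (\<forall>v\<in>L. \<forall>r::real. \<phi> (\<lambda>p. r *\<^sub>R v p) = (\<lambda>p. r *\<^sub>R \<phi> v p))"

text \<open>Linear independence follows from orthonormality.\<close>

definition orthonormal_basis ::
  "('g \<Rightarrow> 'e::real_vector) set \<Rightarrow> (('g \<Rightarrow> 'e) \<Rightarrow> ('g \<Rightarrow> 'e) \<Rightarrow> real) \<Rightarrow> nat \<Rightarrow> (nat \<Rightarrow> 'g \<Rightarrow> 'e) \<Rightarrow> bool" where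
  "orthonormal_basis L ip n B \<longleftrightarrow>
     (\<forall>i\<in>{1..n}. B i \<in> L) \<and>
     (\<forall>i\<in>{1..n}. \<forall>j\<in>{1..n}. ip (B i) (B j) = (if i = j then 1 else 0)) \<and>
     (\<forall>v\<in>L. \<exists>a :: nat \<Rightarrow> real. v = (\<lambda>p. \<Sum>i=1..n. a i *\<^sub>R B i p))"

end

theory Submission
  imports Defs
begin

text \<open>
  The basis \<open>Xs\<close> is orthonormal for the first metric and consists of eigenvectors of \<open>\<phi>\<close>, so for
  the second metric it is orthogonal with squared lengths \<open>lam i\<close>: at the identity by the definition
  of \<open>\<phi>\<close>, and at every other point because the metric and the fields are left-invariant. The
  formula for the curvature holds for any orthogonal frame \<open>E\<close> whose squared lengths are constant
  and whose brackets have constant coefficients \<open>\<alpha>\<close>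
  (lemma \<open>sectional_curvature_of_orthogonal_frame\<close>).

  Inner products of the frame being constant, compatibility with the metric says that
  \<open>\<Gamma> i j k = g (\<nabla> (E i) (E j)) (E k)\<close> is antisymmetric in \<open>j, k\<close>, while vanishing torsion says that
  \<open>\<Gamma> i j k - \<Gamma> j i k = lam k * \<alpha> i j k\<close>. As in the uniqueness proof for the Levi-Civita connection,
  these two relations determine \<open>\<Gamma>\<close> (lemma \<open>koszul_unique\<close>), so that \<open>\<Gamma>\<close> is constant and equal to
  \<open>koszul lam \<alpha>\<close>. A frame of \<open>DIM('e)\<close> orthogonal non-zero fields spans every tangent space, and
  \<open>\<nabla> (E i) (E j)\<close> is therefore the combination of the \<open>E k\<close> with constant coefficients
  \<open>\<Gamma> i j k / lam k\<close> (lemma \<open>connection_of_orthogonal_frame\<close>). On such combinations the connection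
  acts linearly, since constants have derivative zero; hence the curvature becomes a sum over one
  index of products of the constants \<open>\<Gamma>\<close>, \<open>\<alpha>\<close> and \<open>1 / lam l\<close>, and the asserted formula is an identity between the
  summands (lemma \<open>koszul_curvature_summand\<close>).

  The analytic content is confined to showing that combinations of smooth vector fields with
  constant coefficients are smooth, without which the axioms of a connection do not apply to them.
\<close>

section \<open>Linear combinations of smooth functions\<close>

text \<open>The derivatives in \<open>Ck_on\<close> are taken in the whole space, so that agreement on \<open>S\<close> carries over
  to derivatives only when \<open>S\<close> is open.\<close>

lemma Ck_on_cong:
  fixes f g :: "'a::euclidean_space \<Rightarrow> 'b::real_normed_vector"
  assumes "open S" and "\<And>x. x \<in> S \<Longrightarrow> f x = g x" and "Ck_on k S f"
  shows "Ck_on k S g"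
  using assms(2,3)
proof (induction k arbitrary: f g)
  case 0
  then show ?case
    using continuous_on_cong by (metis Ck_on.simps(1))
next
  case (Suc k)
  have der: "(g has_derivative frechet_derivative f (at x)) (at x)" if "x \<in> S" for x
  proof (rule has_derivative_transform_within_open[OF _ \<open>open S\<close> that])
    show "(f has_derivative frechet_derivative f (at x)) (at x)"
      using Suc.prems(2) that frechet_derivative_works by auto
  qed (use Suc.prems(1) in auto)
  then have eq: "frechet_derivative f (at x) = frechet_derivative g (at x)" if "x \<in> S" for x
    using that frechet_derivative_at by blast
  have "Ck_on k S (\<lambda>x. frechet_derivative g (at x) v)" for v
    using Suc.IH[of "\<lambda>x. frechet_derivative f (at x) v" "\<lambda>x. frechet_derivative g (at x) v"]
      Suc.prems(2) eq by simp
  with der show ?case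
    unfolding Ck_on.simps differentiable_def by blast
qed

lemma Ck_on_add:
  fixes f g :: "'a::euclidean_space \<Rightarrow> 'b::real_normed_vector"
  assumes "open S" and "Ck_on k S f" and "Ck_on k S g"
  shows "Ck_on k S (\<lambda>x. f x + g x)"
  using assms(2,3)
proof (induction k arbitrary: f g)
  case 0
  then show ?case
    by (simp add: continuous_on_add)
next
  case (Suc k)
  have der: "((\<lambda>x. f x + g x) has_derivative
      (\<lambda>v. frechet_derivative f (at x) v + frechet_derivative g (at x) v)) (at x)" if "x \<in> S" for x
    using Suc.prems that by (intro has_derivative_add) (auto simp: frechet_derivative_works)
  have "Ck_on k S (\<lambda>x. frechet_derivative (\<lambda>x. f x + g x) (at x) v)" for v
  proof (rule Ck_on_cong[OF \<open>open S\<close>])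
    show "frechet_derivative f (at x) v + frechet_derivative g (at x) v
        = frechet_derivative (\<lambda>x. f x + g x) (at x) v" if "x \<in> S" for x
      using frechet_derivative_at[OF der[OF that]] by metis
    show "Ck_on k S (\<lambda>x. frechet_derivative f (at x) v + frechet_derivative g (at x) v)"
      using Suc by simp
  qed
  with der show ?case
    unfolding Ck_on.simps differentiable_def by blast
qed

lemma Ck_on_scaleR:
  fixes f :: "'a::euclidean_space \<Rightarrow> 'b::real_normed_vector"
  assumes "open S" and "Ck_on k S f"
  shows "Ck_on k S (\<lambda>x. r *\<^sub>R f x)"
  using assms(2)
proof (induction k arbitrary: f)
  case 0
  then show ?case
    by (simp add: continuous_on_scaleR)
next
  case (Suc k)
  have der: "((\<lambda>x. r *\<^sub>R f x) has_derivative (\<lambda>v. r *\<^sub>R frechet_derivative f (at x) v)) (at x)"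
    if "x \<in> S" for x
    using Suc.prems that by (intro has_derivative_scaleR_right) (auto simp: frechet_derivative_works)
  have "Ck_on k S (\<lambda>x. frechet_derivative (\<lambda>x. r *\<^sub>R f x) (at x) v)" for v
  proof (rule Ck_on_cong[OF \<open>open S\<close>])
    show "r *\<^sub>R frechet_derivative f (at x) v = frechet_derivative (\<lambda>x. r *\<^sub>R f x) (at x) v"
      if "x \<in> S" for x
      using frechet_derivative_at[OF der[OF that]] by metis
    show "Ck_on k S (\<lambda>x. r *\<^sub>R frechet_derivative f (at x) v)"
      using Suc by simp
  qed
  with der show ?case
    unfolding Ck_on.simps differentiable_def by blast
qed

lemma Ck_on_const: "Ck_on k S (\<lambda>x. c)"
proof (induction k arbitrary: c)
  case 0
  then show ?case
    by simp
next
  case (Suc k)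
  have "(\<lambda>x. frechet_derivative (\<lambda>y. c) (at x) v) = (\<lambda>x. 0)" for v
    by (simp add: frechet_derivative_const)
  with Suc show ?case
    by simp
qed

lemma smooth_fun_const: "smooth_fun M (\<lambda>p. r)"
  by (simp add: smooth_fun_def smooth_on_def comp_def Ck_on_const)


section \<open>Linear combinations of vector fields\<close>

lemma chart_at_in_atlas:
  assumes "smooth_manifold M" and "p \<in> points M"
  shows "chart_at M p \<in> atlas M" and "p \<in> fst (chart_at M p)"
proof -
  have "\<exists>c. c \<in> atlas M \<and> p \<in> fst c"
    using assms unfolding smooth_manifold_def by blast
  from someI_ex[OF this] show "chart_at M p \<in> atlas M" "p \<in> fst (chart_at M p)"
    unfolding chart_at_def by auto
qed

lemma chart_domain_subset_points:
  assumes "smooth_manifold M" and "c \<in> atlas M"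
  shows "fst c \<subseteq> points M"
  using assms unfolding smooth_manifold_def by blast

lemma chart_image_open:
  assumes "smooth_manifold M" and "c \<in> atlas M"
  shows "open (snd c ` fst c)"
  using assms unfolding smooth_manifold_def by blast

text \<open>In the preferred chart at \<open>p\<close> a chart becomes a transition map, which is differentiable; thus
  the value of \<open>frechet_derivative\<close> is a genuine, and in particular linear, derivative.\<close>

lemma mderiv_chart_linear:
  fixes M :: "('g, 'e::euclidean_space) manifold"
  assumes M: "smooth_manifold M" and c: "c \<in> atlas M" and p: "p \<in> fst c"
  shows "linear (mderiv M p (snd c))"
proof -
  let ?d = "chart_at M p"
  have pM: "p \<in> points M"
    using chart_domain_subset_points[OF M c] p by blast
  have "smooth_on (snd ?d ` (fst ?d \<inter> fst c)) (snd c \<circ> inv_chart ?d)"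
    using M c chart_at_in_atlas(1)[OF M pM] unfolding smooth_manifold_def by blast
  then have "Ck_on (Suc 0) (snd ?d ` (fst ?d \<inter> fst c)) (snd c \<circ> inv_chart ?d)"
    unfolding smooth_on_def by blast
  moreover have "snd ?d p \<in> snd ?d ` (fst ?d \<inter> fst c)"
    using p chart_at_in_atlas(2)[OF M pM] by blast
  ultimately have "(snd c \<circ> inv_chart ?d) differentiable (at (snd ?d p))"
    unfolding Ck_on.simps by blast
  then show ?thesis
    unfolding mderiv_def by (simp add: linear_frechet_derivative)
qed

lemma mderiv_eq_0_if_constant:
  fixes M :: "('g, 'e::euclidean_space) manifold"
  assumes M: "smooth_manifold M" and p: "p \<in> points M" and f: "\<And>q. q \<in> points M \<Longrightarrow> f q = c"
  shows "mderiv M p f v = 0"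
proof -
  let ?d = "chart_at M p"
  note d = chart_at_in_atlas[OF M p]
  have "((f \<circ> inv_chart ?d) has_derivative (\<lambda>v. 0)) (at (snd ?d p))"
  proof (rule has_derivative_transform_within_open[OF _ chart_image_open[OF M d(1)]])
    show "((\<lambda>x. c) has_derivative (\<lambda>v. 0)) (at (snd ?d p))"
      by simp
    show "c = (f \<circ> inv_chart ?d) x" if "x \<in> snd ?d ` fst ?d" for x
      using f chart_domain_subset_points[OF M d(1)] inv_into_into[OF that] by auto
  qed (use d in blast)
  then show ?thesis
    unfolding mderiv_def by (metis frechet_derivative_at)
qed

lemma vector_fields_add:
  fixes M :: "('g, 'e::euclidean_space) manifold"
  assumes M: "smooth_manifold M" and U: "U \<in> vector_fields M" and V: "V \<in> vector_fields M"
  shows "(\<lambda>p. U p + V p) \<in> vector_fields M"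
proof -
  have "smooth_on (snd c ` fst c) (in_chart M c (\<lambda>p. U p + V p))" if c: "c \<in> atlas M" for c
    unfolding smooth_on_def
  proof
    fix k
    note S = chart_image_open[OF M c]
    show "Ck_on k (snd c ` fst c) (in_chart M c (\<lambda>p. U p + V p))"
    proof (rule Ck_on_cong[OF S])
      show "Ck_on k (snd c ` fst c) (\<lambda>x. in_chart M c U x + in_chart M c V x)"
        using U V c by (intro Ck_on_add[OF S]) (auto simp: vector_fields_def smooth_on_def)
      show "in_chart M c U x + in_chart M c V x = in_chart M c (\<lambda>p. U p + V p) x"
        if "x \<in> snd c ` fst c" for x
        using mderiv_chart_linear[OF M c inv_into_into[OF that]]
        unfolding in_chart_def by (simp add: linear_add)
    qed
  qed
  with U V show ?thesis
    unfolding vector_fields_def by simp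
qed

lemma vector_fields_scaleR:
  fixes M :: "('g, 'e::euclidean_space) manifold"
  assumes M: "smooth_manifold M" and U: "U \<in> vector_fields M"
  shows "(\<lambda>p. r *\<^sub>R U p) \<in> vector_fields M"
proof -
  have "smooth_on (snd c ` fst c) (in_chart M c (\<lambda>p. r *\<^sub>R U p))" if c: "c \<in> atlas M" for c
    unfolding smooth_on_def
  proof
    fix k
    note S = chart_image_open[OF M c]
    show "Ck_on k (snd c ` fst c) (in_chart M c (\<lambda>p. r *\<^sub>R U p))"
    proof (rule Ck_on_cong[OF S])
      show "Ck_on k (snd c ` fst c) (\<lambda>x. r *\<^sub>R in_chart M c U x)"
        using U c by (intro Ck_on_scaleR[OF S]) (auto simp: vector_fields_def smooth_on_def)
      show "r *\<^sub>R in_chart M c U x = in_chart M c (\<lambda>p. r *\<^sub>R U p) x"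
        if "x \<in> snd c ` fst c" for x
        using mderiv_chart_linear[OF M c inv_into_into[OF that]]
        unfolding in_chart_def by (simp add: linear_scale)
    qed
  qed
  with U show ?thesis
    unfolding vector_fields_def by simp
qed

lemma vector_fields_zero:
  fixes M :: "('g, 'e::euclidean_space) manifold"
  assumes M: "smooth_manifold M"
  shows "(\<lambda>p. 0) \<in> vector_fields M"
proof -
  have "smooth_on (snd c ` fst c) (in_chart M c (\<lambda>p. 0))" if c: "c \<in> atlas M" for c
    unfolding smooth_on_def
  proof
    fix k
    show "Ck_on k (snd c ` fst c) (in_chart M c (\<lambda>p. 0))"
    proof (rule Ck_on_cong[OF chart_image_open[OF M c]])
      show "0 = in_chart M c (\<lambda>p. 0) x" if "x \<in> snd c ` fst c" for x
        using mderiv_chart_linear[OF M c inv_into_into[OF that]]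
        unfolding in_chart_def by (simp add: linear_0)
    qed (rule Ck_on_const)
  qed
  then show ?thesis
    unfolding vector_fields_def by simp
qed

lemma vector_fields_sum:
  fixes M :: "('g, 'e::euclidean_space) manifold"
  assumes M: "smooth_manifold M" and E: "\<And>k. k \<in> I \<Longrightarrow> E k \<in> vector_fields M"
  shows "(\<lambda>p. \<Sum>k\<in>I. a k *\<^sub>R E k p) \<in> vector_fields M"
  using E
proof (induction I rule: infinite_finite_induct)
  case (insert i I)
  then show ?case
    by (simp add: vector_fields_add[OF M] vector_fields_scaleR[OF M])
qed (simp_all add: vector_fields_zero[OF M])


section \<open>Connections on combinations with constant coefficients\<close>

context
  fixes M :: "('g, 'e::euclidean_space) manifold"
    and nabla :: "('g \<Rightarrow> 'e) \<Rightarrow> ('g \<Rightarrow> 'e) \<Rightarrow> 'g \<Rightarrow> 'e"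
  assumes M: "smooth_manifold M" and nabla: "affine_connection M nabla"
begin

lemma connection_scaleR_left:
  assumes "U \<in> vector_fields M" and "V \<in> vector_fields M"
  shows "nabla (\<lambda>p. r *\<^sub>R U p) V = (\<lambda>p. r *\<^sub>R nabla U V p)"
  using nabla assms smooth_fun_const[of M r] unfolding affine_connection_def by fast

lemma connection_scaleR_right:
  assumes U: "U \<in> vector_fields M" and V: "V \<in> vector_fields M"
  shows "nabla U (\<lambda>p. r *\<^sub>R V p) = (\<lambda>p. r *\<^sub>R nabla U V p)"
proof -
  have *: "nabla U (\<lambda>p. r *\<^sub>R V p)
      = (\<lambda>p. r *\<^sub>R nabla U V p + mderiv M p (\<lambda>p. r) (U p) *\<^sub>R V p)"
    using nabla U V smooth_fun_const[of M r] unfolding affine_connection_def by fast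
  \<comment> \<open>Off the manifold the value of \<open>mderiv\<close> is unspecified, but there \<open>V\<close> is zero.\<close>
  have "mderiv M p (\<lambda>p. r) (U p) *\<^sub>R V p = 0" for p
    using mderiv_eq_0_if_constant[OF M, of p "\<lambda>p. r" r] V
    by (cases "p \<in> points M") (auto simp: vector_fields_def)
  with * show ?thesis
    by simp
qed

lemma connection_zero_left:
  assumes "V \<in> vector_fields M"
  shows "nabla (\<lambda>p. 0) V = (\<lambda>p. 0)"
  using connection_scaleR_left[OF vector_fields_zero[OF M] assms, of 0] by simp

lemma connection_zero_right:
  assumes "U \<in> vector_fields M"
  shows "nabla U (\<lambda>p. 0) = (\<lambda>p. 0)"
  using connection_scaleR_right[OF assms vector_fields_zero[OF M], of 0] by simp

lemma connection_add_left:
  assumes "U \<in> vector_fields M" and "U' \<in> vector_fields M" and "V \<in> vector_fields M"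
  shows "nabla (\<lambda>p. U p + U' p) V = (\<lambda>p. nabla U V p + nabla U' V p)"
  using nabla assms unfolding affine_connection_def by blast

lemma connection_add_right:
  assumes "U \<in> vector_fields M" and "V \<in> vector_fields M" and "V' \<in> vector_fields M"
  shows "nabla U (\<lambda>p. V p + V' p) = (\<lambda>p. nabla U V p + nabla U V' p)"
  using nabla assms unfolding affine_connection_def by blast

lemma connection_sum_left:
  assumes "\<And>k. k \<in> I \<Longrightarrow> E k \<in> vector_fields M" and V: "V \<in> vector_fields M"
  shows "nabla (\<lambda>p. \<Sum>k\<in>I. a k *\<^sub>R E k p) V = (\<lambda>p. \<Sum>k\<in>I. a k *\<^sub>R nabla (E k) V p)"
  using assms(1)
proof (induction I rule: infinite_finite_induct)
  case (insert i I)
  then show ?case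
    by (simp add: connection_add_left connection_scaleR_left V vector_fields_scaleR[OF M]
        vector_fields_sum[OF M])
qed (simp_all add: connection_zero_left V)

lemma connection_sum_right:
  assumes "\<And>k. k \<in> I \<Longrightarrow> E k \<in> vector_fields M" and U: "U \<in> vector_fields M"
  shows "nabla U (\<lambda>p. \<Sum>k\<in>I. a k *\<^sub>R E k p) = (\<lambda>p. \<Sum>k\<in>I. a k *\<^sub>R nabla U (E k) p)"
  using assms(1)
proof (induction I rule: infinite_finite_induct)
  case (insert i I)
  then show ?case
    by (simp add: connection_add_right connection_scaleR_right U vector_fields_scaleR[OF M]
        vector_fields_sum[OF M])
qed (simp_all add: connection_zero_right U)

end


section \<open>Orthogonal bases of a tangent space\<close>

lemma bilinear_sum_scaleR_left:
  assumes "bilinear b"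
  shows "b (\<Sum>k\<in>I. a k *\<^sub>R e k) w = (\<Sum>k\<in>I. a k * b (e k) w)"
proof -
  have "linear (\<lambda>v. b v w)"
    using assms unfolding bilinear_def by blast
  then show ?thesis
    by (simp add: linear_sum[of "\<lambda>v. b v w"] linear_scale[of "\<lambda>v. b v w"])
qed

lemma bilinear_orthogonal_coefficient:
  assumes "bilinear b" and "finite I" and "j \<in> I"
    and "\<And>i. i \<in> I \<Longrightarrow> b (e i) (e j) = (if i = j then lam j else 0)"
  shows "b (\<Sum>k\<in>I. a k *\<^sub>R e k) (e j) = a j * lam j"
proof -
  have "b (\<Sum>k\<in>I. a k *\<^sub>R e k) (e j) = (\<Sum>k\<in>I. a k * b (e k) (e j))"
    by (rule bilinear_sum_scaleR_left[OF assms(1)])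
  also have "\<dots> = (\<Sum>k\<in>I. if k = j then a j * lam j else 0)"
    by (rule sum.cong) (auto simp: assms(4))
  finally show ?thesis
    using assms(2,3) by simp
qed

text \<open>Orthogonal vectors of non-zero length are independent, and \<open>DIM('e)\<close> of them span; pairing
  with \<open>e k\<close> then reads off the coefficients.\<close>

lemma orthogonal_expansion:
  fixes e :: "nat \<Rightarrow> 'e::euclidean_space"
  assumes b: "bilinear b" and I: "finite I" "card I = DIM('e)"
    and orth: "\<And>i j. i \<in> I \<Longrightarrow> j \<in> I \<Longrightarrow> b (e i) (e j) = (if i = j then lam j else 0)"
    and lam: "\<And>i. i \<in> I \<Longrightarrow> lam i \<noteq> 0"
  shows "v = (\<Sum>k\<in>I. (b v (e k) / lam k) *\<^sub>R e k)"
proof -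
  have inj: "inj_on e I"
    by (rule inj_onI) (metis orth lam)
  have "independent (e ` I)"
  proof (rule independent_if_scalars_zero)
    show "finite (e ` I)"
      using I by simp
    fix f x
    assume "(\<Sum>x\<in>e ` I. f x *\<^sub>R x) = 0" and "x \<in> e ` I"
    then obtain j where j: "j \<in> I" "x = e j" and "(\<Sum>k\<in>I. f (e k) *\<^sub>R e k) = 0"
      by (auto simp: sum.reindex[OF inj])
    then have "f (e j) * lam j = b 0 (e j)"
      using bilinear_orthogonal_coefficient[OF b I(1) j(1), of e lam "\<lambda>k. f (e k)"] orth by simp
    then show "f x = 0"
      using lam j b by (simp add: bilinear_lzero)
  qed
  then have "UNIV \<subseteq> span (e ` I)"
    by (intro card_ge_dim_independent) (simp_all add: card_image[OF inj] I)
  then obtain f where "v = (\<Sum>x\<in>e ` I. f x *\<^sub>R x)"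
    using span_finite[of "e ` I"] I by auto
  then have v: "v = (\<Sum>k\<in>I. f (e k) *\<^sub>R e k)"
    by (simp add: sum.reindex[OF inj])
  have "b v (e j) / lam j = f (e j)" if "j \<in> I" for j
    unfolding v using bilinear_orthogonal_coefficient[OF b I(1) that, of e lam] orth lam that by simp
  then show ?thesis
    using v by simp
qed


section \<open>The Koszul formula for frames with constant inner products\<close>

text \<open>Koszul's formula for \<open>g (\<nabla> (E i) (E j)) (E k)\<close>, for a frame that is orthogonal with squared
  lengths \<open>lam\<close> and has structure constants \<open>\<alpha>\<close>.\<close>

definition koszul :: "(nat \<Rightarrow> real) \<Rightarrow> (nat \<Rightarrow> nat \<Rightarrow> nat \<Rightarrow> real) \<Rightarrow> nat \<Rightarrow> nat \<Rightarrow> nat \<Rightarrow> real" where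
  "koszul lam \<alpha> i j k = (lam k * \<alpha> i j k - lam i * \<alpha> j k i + lam j * \<alpha> k i j) / 2"

text \<open>Add the torsion identity over the cyclic permutations of \<open>i, j, k\<close>, one of them with the
  opposite sign: antisymmetry cancels everything except twice \<open>\<Gamma> i j k\<close>.\<close>

lemma koszul_unique:
  assumes "\<And>i j k. i \<in> I \<Longrightarrow> j \<in> I \<Longrightarrow> k \<in> I \<Longrightarrow> \<Gamma> i j k = - \<Gamma> i k j"
    and "\<And>i j k. i \<in> I \<Longrightarrow> j \<in> I \<Longrightarrow> k \<in> I \<Longrightarrow> \<Gamma> i j k - \<Gamma> j i k = lam k * \<alpha> i j k"
    and "i \<in> I" and "j \<in> I" and "k \<in> I"
  shows "\<Gamma> i j k = koszul lam \<alpha> i j k"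
  using assms(1)[OF assms(3-5)] assms(1)[OF assms(4,5,3)] assms(1)[OF assms(5,3,4)]
    assms(2)[OF assms(3-5)] assms(2)[OF assms(4,5,3)] assms(2)[OF assms(5,3,4)]
  unfolding koszul_def by (simp add: field_simps)

text \<open>The three products on the left arise from \<open>\<nabla> (E i) (\<nabla> (E j) (E j))\<close>,
  \<open>\<nabla> (E j) (\<nabla> (E i) (E j))\<close> and \<open>\<nabla> (lie_bracket M (E i) (E j)) (E j)\<close>, each paired with \<open>E i\<close>.
  Antisymmetry reduces the \<open>\<alpha>\<close> on both sides to the five values \<open>\<alpha> i j l\<close>, \<open>\<alpha> j l i\<close>,
  \<open>\<alpha> l i j\<close>, \<open>\<alpha> l i i\<close>, \<open>\<alpha> l j j\<close>, in which the equation is a polynomial identity after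
  clearing denominators.\<close>

lemma koszul_curvature_summand:
  assumes nonzero: "lam i \<noteq> 0" "lam j \<noteq> 0" "lam l \<noteq> 0"
    and antisym: "\<And>a b c. a \<in> {i, j, l} \<Longrightarrow> b \<in> {i, j, l} \<Longrightarrow> c \<in> {i, j, l} \<Longrightarrow> \<alpha> a b c = - \<alpha> b a c"
  shows "(koszul lam \<alpha> j j l / lam l * koszul lam \<alpha> i l i
        - koszul lam \<alpha> i j l / lam l * koszul lam \<alpha> j l i
        - \<alpha> i j l * koszul lam \<alpha> l j i) / (lam i * lam j)
    = 1 / 4 * (- 4 / lam l * \<alpha> l j j * \<alpha> l i i
        - 2 / lam l * \<alpha> l j i * \<alpha> i l j
        + 2 / lam j * \<alpha> i j l * \<alpha> j l i
        + 2 / lam i * \<alpha> i l j * \<alpha> j i l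
        - 3 * lam l / (lam i * lam j) * (\<alpha> i j l)\<^sup>2
        + lam j / (lam i * lam l) * (\<alpha> i l j)\<^sup>2
        + lam i / (lam j * lam l) * (\<alpha> l j i)\<^sup>2)"
proof -
  have diag: "\<alpha> j j l = 0" "\<alpha> i i l = 0" "\<alpha> i i i = 0"
    using antisym[of j j l] antisym[of i i l] antisym[of i i i] by simp_all
  have swap: "\<alpha> j l j = - \<alpha> l j j" "\<alpha> i l i = - \<alpha> l i i"
    "\<alpha> j i l = - \<alpha> i j l" "\<alpha> l j i = - \<alpha> j l i" "\<alpha> i l j = - \<alpha> l i j"
    using antisym[of j l j] antisym[of i l i] antisym[of j i l] antisym[of l j i] antisym[of i l j]
    by simp_all
  show ?thesis
    unfolding koszul_def diag swap using nonzero by (simp add: field_simps power2_eq_square)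
qed

context
  fixes M :: "('g, 'e::euclidean_space) manifold"
    and g :: "'g \<Rightarrow> 'e \<Rightarrow> 'e \<Rightarrow> real"
    and nabla :: "('g \<Rightarrow> 'e) \<Rightarrow> ('g \<Rightarrow> 'e) \<Rightarrow> 'g \<Rightarrow> 'e"
    and n :: nat
    and E :: "nat \<Rightarrow> 'g \<Rightarrow> 'e"
    and lam :: "nat \<Rightarrow> real"
    and \<alpha> :: "nat \<Rightarrow> nat \<Rightarrow> nat \<Rightarrow> real"
  assumes M: "smooth_manifold M" and g: "riemannian_metric M g"
    and LC: "levi_civita_connection M g nabla"
    and n: "n = DIM('e)"
    and E: "\<And>i. i \<in> {1..n} \<Longrightarrow> E i \<in> vector_fields M"
    and orth: "\<And>p i j. p \<in> points M \<Longrightarrow> i \<in> {1..n} \<Longrightarrow> j \<in> {1..n} \<Longrightarrow>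
      g p (E i p) (E j p) = (if i = j then lam j else 0)"
    and lam: "\<And>i. i \<in> {1..n} \<Longrightarrow> lam i \<noteq> 0"
    and bracket: "\<And>i j. i \<in> {1..n} \<Longrightarrow> j \<in> {1..n} \<Longrightarrow>
      lie_bracket M (E i) (E j) = (\<lambda>p. \<Sum>k=1..n. \<alpha> i j k *\<^sub>R E k p)"
begin

lemma frame_coefficient:
  assumes "p \<in> points M" and "j \<in> {1..n}"
  shows "g p (\<Sum>k=1..n. a k *\<^sub>R E k p) (E j p) = a j * lam j"
proof (rule bilinear_orthogonal_coefficient[where b = "g p" and e = "\<lambda>k. E k p"])
  show "bilinear (g p)"
    using g assms unfolding riemannian_metric_def by blast
qed (use assms orth in auto)

text \<open>The two hypotheses of \<open>koszul_unique\<close> are metric compatibility and vanishing torsion. In the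
  former the derivative drops out, the inner products of the frame being constant.\<close>

lemma connection_frame_coefficient:
  assumes p: "p \<in> points M" and ijk: "i \<in> {1..n}" "j \<in> {1..n}" "k \<in> {1..n}"
  shows "g p (nabla (E i) (E j) p) (E k p) = koszul lam \<alpha> i j k"
proof -
  have bil: "bilinear (g p)" and sym: "\<And>v w. g p v w = g p w v"
    using g p unfolding riemannian_metric_def by blast+
  show ?thesis
  proof (rule koszul_unique[where I = "{1..n}" and \<Gamma> = "\<lambda>i j k. g p (nabla (E i) (E j) p) (E k p)"])
    fix i j k assume ijk: "i \<in> {1..n}" "j \<in> {1..n}" "k \<in> {1..n}"
    have "mderiv M p (\<lambda>q. g q (E j q) (E k q)) (E i p)
        = g p (nabla (E i) (E j) p) (E k p) + g p (E j p) (nabla (E i) (E k) p)"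
      using LC E[OF ijk(1)] E[OF ijk(2)] E[OF ijk(3)] p
      unfolding levi_civita_connection_def by blast
    moreover have "mderiv M p (\<lambda>q. g q (E j q) (E k q)) (E i p) = 0"
      using orth ijk by (intro mderiv_eq_0_if_constant[OF M p]) auto
    ultimately show "g p (nabla (E i) (E j) p) (E k p) = - g p (nabla (E i) (E k) p) (E j p)"
      using sym by (simp add: add_eq_0_iff)
  next
    fix i j k assume ijk: "i \<in> {1..n}" "j \<in> {1..n}" "k \<in> {1..n}"
    have "(\<lambda>p. nabla (E i) (E j) p - nabla (E j) (E i) p) = lie_bracket M (E i) (E j)"
      using LC E[OF ijk(1)] E[OF ijk(2)] unfolding levi_civita_connection_def by blast
    then have "nabla (E i) (E j) p - nabla (E j) (E i) p = (\<Sum>k=1..n. \<alpha> i j k *\<^sub>R E k p)"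
      using bracket ijk by (metis (no_types, lifting))
    then have "g p (nabla (E i) (E j) p - nabla (E j) (E i) p) (E k p) = \<alpha> i j k * lam k"
      using frame_coefficient[OF p ijk(3)] by simp
    then show "g p (nabla (E i) (E j) p) (E k p) - g p (nabla (E j) (E i) p) (E k p)
        = lam k * \<alpha> i j k"
      by (simp add: bilinear_lsub[OF bil] mult.commute)
  qed (use ijk in auto)
qed

lemma connection_of_orthogonal_frame:
  assumes ij: "i \<in> {1..n}" "j \<in> {1..n}"
  shows "nabla (E i) (E j) = (\<lambda>p. \<Sum>k=1..n. (koszul lam \<alpha> i j k / lam k) *\<^sub>R E k p)"
proof
  fix p
  show "nabla (E i) (E j) p = (\<Sum>k=1..n. (koszul lam \<alpha> i j k / lam k) *\<^sub>R E k p)"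
  proof (cases "p \<in> points M")
    case True
    have "bilinear (g p)"
      using g True unfolding riemannian_metric_def by blast
    then have "nabla (E i) (E j) p
        = (\<Sum>k=1..n. (g p (nabla (E i) (E j) p) (E k p) / lam k) *\<^sub>R E k p)"
      by (rule orthogonal_expansion) (use n orth[OF True] lam in auto)
    then show ?thesis
      using connection_frame_coefficient[OF True ij] by simp
  next
    case False
    have "nabla (E i) (E j) \<in> vector_fields M"
      using LC E[OF ij(1)] E[OF ij(2)]
      unfolding levi_civita_connection_def affine_connection_def by blast
    with False E show ?thesis
      by (simp add: vector_fields_def)
  qed
qed

lemma structure_constants_antisym:
  assumes p: "p \<in> points M" and ijk: "i \<in> {1..n}" "j \<in> {1..n}" "k \<in> {1..n}"
  shows "\<alpha> i j k = - \<alpha> j i k"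
proof -
  have bil: "bilinear (g p)"
    using g p unfolding riemannian_metric_def by blast
  have "lie_bracket M (E i) (E j) p = - lie_bracket M (E j) (E i) p"
    by (simp add: lie_bracket_def Let_def)
  then have "(\<Sum>k=1..n. \<alpha> i j k *\<^sub>R E k p) = - (\<Sum>k=1..n. \<alpha> j i k *\<^sub>R E k p)"
    unfolding bracket[OF ijk(1,2)] bracket[OF ijk(2,1)] .
  then have "\<alpha> i j k * lam k = - (\<alpha> j i k * lam k)"
    using frame_coefficient[OF p ijk(3)] by (metis bilinear_lneg[OF bil])
  then show ?thesis
    using lam[OF ijk(3)] by (metis mult_minus_left mult_right_cancel)
qed

lemma curvature_of_orthogonal_frame:
  assumes p: "p \<in> points M" and ij: "i \<in> {1..n}" "j \<in> {1..n}"
  shows "g p (curvature M nabla (E i) (E j) (E j) p) (E i p)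
    = (\<Sum>l=1..n. koszul lam \<alpha> j j l / lam l * koszul lam \<alpha> i l i
        - koszul lam \<alpha> i j l / lam l * koszul lam \<alpha> j l i
        - \<alpha> i j l * koszul lam \<alpha> l j i)"
proof -
  have bil: "bilinear (g p)"
    using g p unfolding riemannian_metric_def by blast
  have aff: "affine_connection M nabla"
    using LC unfolding levi_civita_connection_def by blast
  \<comment> \<open>The coefficients of \<open>\<nabla> (E b) (E c)\<close> being constant, \<open>\<nabla> (E a)\<close> passes through them.\<close>
  have second: "g p (nabla (E a) (nabla (E b) (E c)) p) (E i p)
      = (\<Sum>l=1..n. koszul lam \<alpha> b c l / lam l * koszul lam \<alpha> a l i)"
    if abc: "a \<in> {1..n}" "b \<in> {1..n}" "c \<in> {1..n}" for a b c
  proof -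
    have "nabla (E a) (nabla (E b) (E c))
        = (\<lambda>p. \<Sum>l=1..n. (koszul lam \<alpha> b c l / lam l) *\<^sub>R nabla (E a) (E l) p)"
      unfolding connection_of_orthogonal_frame[OF abc(2,3)]
      by (rule connection_sum_right[OF M aff]) (use E abc in auto)
    then have "g p (nabla (E a) (nabla (E b) (E c)) p) (E i p)
        = (\<Sum>l=1..n. koszul lam \<alpha> b c l / lam l * g p (nabla (E a) (E l) p) (E i p))"
      by (simp add: bilinear_sum_scaleR_left[OF bil])
    then show ?thesis
      using connection_frame_coefficient[OF p] abc ij by simp
  qed
  have "nabla (lie_bracket M (E i) (E j)) (E j) = (\<lambda>p. \<Sum>l=1..n. \<alpha> i j l *\<^sub>R nabla (E l) (E j) p)"
    unfolding bracket[OF ij] by (rule connection_sum_left[OF M aff]) (use E ij in auto)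
  then have "g p (nabla (lie_bracket M (E i) (E j)) (E j) p) (E i p)
      = (\<Sum>l=1..n. \<alpha> i j l * g p (nabla (E l) (E j) p) (E i p))"
    by (simp add: bilinear_sum_scaleR_left[OF bil])
  then have "g p (nabla (lie_bracket M (E i) (E j)) (E j) p) (E i p)
      = (\<Sum>l=1..n. \<alpha> i j l * koszul lam \<alpha> l j i)"
    using connection_frame_coefficient[OF p] ij by simp
  with second ij show ?thesis
    by (simp add: curvature_def bilinear_lsub[OF bil] sum_subtractf)
qed

lemma sectional_curvature_of_orthogonal_frame:
  assumes p: "p \<in> points M" and ij: "i \<in> {1..n}" "j \<in> {1..n}" "i \<noteq> j"
  shows "sectional_curvature M g nabla (E i) (E j) p =
    1 / 4 * (\<Sum>l=1..n. - 4 / lam l * \<alpha> l j j * \<alpha> l i i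
        - 2 / lam l * \<alpha> l j i * \<alpha> i l j
        + 2 / lam j * \<alpha> i j l * \<alpha> j l i
        + 2 / lam i * \<alpha> i l j * \<alpha> j i l
        - 3 * lam l / (lam i * lam j) * (\<alpha> i j l)\<^sup>2
        + lam j / (lam i * lam l) * (\<alpha> i l j)\<^sup>2
        + lam i / (lam j * lam l) * (\<alpha> l j i)\<^sup>2)"
proof -
  have "sectional_curvature M g nabla (E i) (E j) p
      = g p (curvature M nabla (E i) (E j) (E j) p) (E i p) / (lam i * lam j)"
    using ij by (simp add: sectional_curvature_def orth[OF p])
  then show ?thesis
    unfolding curvature_of_orthogonal_frame[OF p ij(1,2)] sum_divide_distrib sum_distrib_left
  proof (elim ssubst, intro sum.cong refl koszul_curvature_summand)
    fix l a b c
    assume "l \<in> {1..n}" "a \<in> {i, j, l}" "b \<in> {i, j, l}" "c \<in> {i, j, l}"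
    then show "\<alpha> a b c = - \<alpha> b a c"
      using ij by (intro structure_constants_antisym[OF p]) auto
  qed (use lam ij in auto)
qed

end


section \<open>Left-invariant frames\<close>

text \<open>Left translation by \<open>p\<close> carries both the metric and the fields from the identity to \<open>p\<close>.\<close>

lemma left_invariant_metric_eq_induced_inner:
  assumes "group G" and "left_invariant_metric G M g"
    and "U \<in> lie_algebra G M" and "V \<in> lie_algebra G M" and p: "p \<in> carrier G"
  shows "g p (U p) (V p) = induced_inner G g U V"
proof -
  interpret group G by fact
  have translate: "W p = left_translation_map G M p \<one>\<^bsub>G\<^esub> (W \<one>\<^bsub>G\<^esub>)" if "W \<in> lie_algebra G M" for W
  proof -
    have "W (p \<otimes>\<^bsub>G\<^esub> \<one>\<^bsub>G\<^esub>) = left_translation_map G M p \<one>\<^bsub>G\<^esub> (W \<one>\<^bsub>G\<^esub>)"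
      using that p one_closed unfolding lie_algebra_def by blast
    then show ?thesis
      using p by simp
  qed
  have "g (p \<otimes>\<^bsub>G\<^esub> \<one>\<^bsub>G\<^esub>) (left_translation_map G M p \<one>\<^bsub>G\<^esub> v)
      (left_translation_map G M p \<one>\<^bsub>G\<^esub> w) = g \<one>\<^bsub>G\<^esub> v w" for v w
    using assms(2) p one_closed unfolding left_invariant_metric_def by blast
  then show ?thesis
    using p by (simp add: induced_inner_def translate[OF assms(3)] translate[OF assms(4)])
qed

theorem proposition2p3:
  fixes G :: "'g monoid"
    and M :: "('g, 'e::euclidean_space) manifold"
    and n :: nat
    and h gX :: "'g \<Rightarrow> 'e \<Rightarrow> 'e \<Rightarrow> real"
    and X :: "'g \<Rightarrow> 'e"
    and nabla :: "('g \<Rightarrow> 'e) \<Rightarrow> ('g \<Rightarrow> 'e) \<Rightarrow> 'g \<Rightarrow> 'e"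
    and \<phi> :: "('g \<Rightarrow> 'e) \<Rightarrow> 'g \<Rightarrow> 'e"
    and Xs :: "nat \<Rightarrow> 'g \<Rightarrow> 'e"
    and lam :: "nat \<Rightarrow> real"
    and \<alpha> :: "nat \<Rightarrow> nat \<Rightarrow> nat \<Rightarrow> real"
  assumes "lie_group G M" and "n = DIM('e)"
    and "left_invariant_metric G M h"
    and "X \<in> lie_algebra G M" and "X \<noteq> (\<lambda>p. 0)" and "induced_norm G h X < 1"
    and "left_invariant_metric G M gX"
    and "\<forall>v\<in>lie_algebra G M. \<forall>z\<in>lie_algebra G M.
           induced_inner G gX v z =
             (1 + induced_norm G h X) *
               (induced_inner G h v z
                + 1 / induced_norm G h X * induced_inner G h X v * induced_inner G h X z)"
    and "levi_civita_connection M gX nabla"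
    and "linear_endo (lie_algebra G M) \<phi>"
    and "\<forall>v\<in>lie_algebra G M. \<forall>z\<in>lie_algebra G M.
           induced_inner G gX v z = induced_inner G h v (\<phi> z)"
    and "orthonormal_basis (lie_algebra G M) (induced_inner G h) n Xs"
    and "\<forall>i\<in>{1..n}. \<phi> (Xs i) = (\<lambda>p. lam i *\<^sub>R Xs i p)"
    and "\<forall>i\<in>{1..n}. \<forall>j\<in>{1..n}.
           lie_bracket M (Xs i) (Xs j) = (\<lambda>p. \<Sum>k=1..n. \<alpha> i j k *\<^sub>R Xs k p)"
  shows "\<forall>i\<in>{1..n}. \<forall>j\<in>{1..n}. i \<noteq> j \<longrightarrow> (\<forall>p\<in>carrier G.
           sectional_curvature M gX nabla (Xs i) (Xs j) p =
             1 / 4 * (\<Sum>l=1..n.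
               - 4 / lam l * \<alpha> l j j * \<alpha> l i i
               - 2 / lam l * \<alpha> l j i * \<alpha> i l j
               + 2 / lam j * \<alpha> i j l * \<alpha> j l i
               + 2 / lam i * \<alpha> i l j * \<alpha> j i l
               - 3 * lam l / (lam i * lam j) * (\<alpha> i j l)\<^sup>2
               + lam j / (lam i * lam l) * (\<alpha> i l j)\<^sup>2
               + lam i / (lam j * lam l) * (\<alpha> l j i)\<^sup>2))"
proof -
  have grp: "group G" and M: "smooth_manifold M" and carrier: "carrier G = points M"
    using assms(1) unfolding lie_group_def by blast+
  interpret group G by fact
  have gX: "riemannian_metric M gX" and h: "riemannian_metric M h"
    using assms(3,7) unfolding left_invariant_metric_def by blast+
  have one: "\<one>\<^bsub>G\<^esub> \<in> points M"
    using one_closed carrier by simp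
  have Xs: "Xs i \<in> lie_algebra G M" if "i \<in> {1..n}" for i
    using assms(12) that unfolding orthonormal_basis_def by blast
  have Xs_orth: "induced_inner G h (Xs i) (Xs j) = (if i = j then 1 else 0)"
    if "i \<in> {1..n}" "j \<in> {1..n}" for i j
    using assms(12) that unfolding orthonormal_basis_def by blast
  have h_bil: "bilinear (h \<one>\<^bsub>G\<^esub>)"
    using h one unfolding riemannian_metric_def by blast
  have inner_gX: "induced_inner G gX (Xs i) (Xs j) = (if i = j then lam j else 0)"
    if ij: "i \<in> {1..n}" "j \<in> {1..n}" for i j
  proof -
    have "induced_inner G gX (Xs i) (Xs j) = induced_inner G h (Xs i) (\<lambda>p. lam j *\<^sub>R Xs j p)"
      using assms(11,13) Xs ij by metis
    also have "\<dots> = lam j * induced_inner G h (Xs i) (Xs j)"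
      by (simp add: induced_inner_def bilinear_rmul[OF h_bil])
    finally show ?thesis
      using Xs_orth ij by simp
  qed
  have lam: "lam i \<noteq> 0" if i: "i \<in> {1..n}" for i
  proof -
    have "h \<one>\<^bsub>G\<^esub> (Xs i \<one>\<^bsub>G\<^esub>) (Xs i \<one>\<^bsub>G\<^esub>) = 1"
      using Xs_orth[OF i i] by (simp add: induced_inner_def)
    then have "Xs i \<one>\<^bsub>G\<^esub> \<noteq> 0"
      using bilinear_lzero[OF h_bil] by fastforce
    then have "induced_inner G gX (Xs i) (Xs i) > 0"
      using gX one unfolding riemannian_metric_def induced_inner_def by blast
    then show ?thesis
      using inner_gX[OF i i] by simp
  qed
  have orth: "gX p (Xs i p) (Xs j p) = (if i = j then lam j else 0)"
    if "p \<in> points M" "i \<in> {1..n}" "j \<in> {1..n}" for p i j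
    using left_invariant_metric_eq_induced_inner[OF grp assms(7) Xs Xs] inner_gX that carrier by simp
  have fields: "Xs i \<in> vector_fields M" if "i \<in> {1..n}" for i
    using Xs[OF that] unfolding lie_algebra_def by blast
  have bracket: "lie_bracket M (Xs i) (Xs j) = (\<lambda>p. \<Sum>k=1..n. \<alpha> i j k *\<^sub>R Xs k p)"
    if "i \<in> {1..n}" "j \<in> {1..n}" for i j
    using assms(14) that by blast
  show ?thesis
    unfolding carrier
    by (intro ballI impI
        sectional_curvature_of_orthogonal_frame[OF M gX assms(9,2) fields orth lam bracket])
qed

end
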